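(* Let $\mathbf K$ be the atomic amalgam of a pasted family $\{\mathbf K_i\}_{i\in I}$ of Kleene lattices. Then $\mathbf K$ is a sharply paraorthomodular poset if and only if it does not contain any atomic loop of order $3$.
   Context: An antitone involution on a poset is a unary operation ${}'$ with $x''=x$ such that $x\leq y$ implies $y'\leq x'$. A bounded poset $(P,\leq,{}',0,1)$ with antitone involution is paraorthomodular if $x\leq y$ and $x'\wedge y=0$ together imply $x=y$; it is orthogonal if $x\vee y$ exists whenever $x\leq y'$; it is sharply paraorthomodular if it is both orthogonal and paraorthomodular. A paraorthomodular lattice is a lattice-ordered paraorthomodular poset. A Kleene lattice is a distributive paraorthomodular lattice satisfying $x\wedge x'\leq y\vee y'$ for all $x,y$. A pasted family of Kleene lattices is a family $\{\mathbf K_i\}_{i\in I}$ of finite Kleene lattices (all with the same $0$ and $1$) such that $|K_i|\geq 6$ for all $i$ and, for $i\neq j$: $K_i\cap K_j$ is either $\{0,1\}$ or an (atomic) Kleene subalgebra of both $\mathbf K_i$ and $\mathbf K_j$ on which the operations $\wedge,\vee,{}',0,1$ of $\mathbf K_i$ and $\mathbf K_j$ coincide; $|K_i\cap K_j|\leq 4$; and every $x\in (K_i\cap K_j)\smallsetminus\{0,1\}$ is either an atom in both $\mathbf K_i$ and $\mathbf K_j$ or a co-atom in both. Its atomic amalgam is $\mathbf K=(K,\leq,{}',0,1)$, where $K=\bigcup_{i\in I}K_i$; $x\leq y$ iff there is $i\in I$ with $x,y\in K_i$ and $x\leq^{\mathbf K_i}y$; and $x'$ is the involute of $x$ computed in any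 $\mathbf K_i$ with $x\in K_i$. This is a well-defined bounded poset with antitone involution. For $n\geq 3$, members $\mathbf K_{i_1},\dots,\mathbf K_{i_n}$ of the family form an atomic loop of order $n$ for $\mathbf K$ if: (1) $|K_{i_j}\cap K_{i_{j+1}}|=4$ for $1\leq j<n$, and $|K_{i_n}\cap K_{i_1}|=4$; (2) for any other pair of distinct indices $1\leq j,k\leq n$ (not mentioned in (1)), $K_{i_j}\cap K_{i_k}=\{0,1\}$; (3) for all $1\leq j<k<l\leq n$, $K_{i_j}\cap K_{i_k}\cap K_{i_l}=\{0,1\}$. *)

theory Defs
  imports "HOL-Algebra.Lattice"
begin

record 'a inv_poset = "'a gorder" +
  invol :: "'a \<Rightarrow> 'a" (\<open>(_\<acute>\<index>)\<close> [1000] 1000)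
  zer :: 'a (\<open>\<zero>\<index>\<close>)
  uno :: 'a (\<open>\<one>\<index>\<close>)

locale bounded_inv_poset = partial_order L for L (structure) +
  assumes zer_least: "least L \<zero> (carrier L)"
    and uno_greatest: "greatest L \<one> (carrier L)"
    and invol_closed: "x \<in> carrier L \<Longrightarrow> x\<acute> \<in> carrier L"
    and invol_invol: "x \<in> carrier L \<Longrightarrow> x\<acute>\<acute> = x"
    and invol_antitone:
      "\<lbrakk>x \<in> carrier L; y \<in> carrier L; x \<sqsubseteq> y\<rbrakk> \<Longrightarrow> y\<acute> \<sqsubseteq> x\<acute>"

text \<open>In a poset that need not be a lattice, an equation between \<open>x\<acute> \<sqinter> y\<close> and \<open>\<zero>\<close> means that
  the infimum of \<open>x\<acute>\<close> and \<open>y\<close> exists and equals \<open>\<zero>\<close>. It is therefore expressed with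
  \<^const>\<open>greatest\<close>, since \<^const>\<open>meet\<close> is a choice term and has an unspecified value when there
  is no infimum.\<close>

locale paraorthomodular_poset = bounded_inv_poset +
  assumes paraorthomodular:
    "\<lbrakk>x \<in> carrier L; y \<in> carrier L; x \<sqsubseteq> y; greatest L \<zero> (Lower L {x\<acute>, y})\<rbrakk> \<Longrightarrow> x = y"

locale orthogonal_poset = bounded_inv_poset +
  assumes orthogonal_sup:
    "\<lbrakk>x \<in> carrier L; y \<in> carrier L; x \<sqsubseteq> y\<acute>\<rbrakk> \<Longrightarrow> \<exists>s. least L s (Upper L {x, y})"

locale sharply_paraorthomodular_poset = orthogonal_poset + paraorthomodular_poset

locale paraorthomodular_lattice = paraorthomodular_poset + lattice

locale kleene_lattice = paraorthomodular_lattice +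
  assumes meet_join_distrib:
    "\<lbrakk>x \<in> carrier L; y \<in> carrier L; z \<in> carrier L\<rbrakk> \<Longrightarrow> x \<sqinter> (y \<squnion> z) = (x \<sqinter> y) \<squnion> (x \<sqinter> z)"
    and kleene: "\<lbrakk>x \<in> carrier L; y \<in> carrier L\<rbrakk> \<Longrightarrow> x \<sqinter> x\<acute> \<sqsubseteq> y \<squnion> y\<acute>"

definition atom :: "('a, 'b) inv_poset_scheme \<Rightarrow> 'a \<Rightarrow> bool" where
  "atom L a \<longleftrightarrow> a \<in> carrier L \<and> a \<noteq> \<zero>\<^bsub>L\<^esub> \<and>
    (\<forall>x \<in> carrier L. x \<sqsubseteq>\<^bsub>L\<^esub> a \<longrightarrow> x = \<zero>\<^bsub>L\<^esub> \<or> x = a)"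

definition coatom :: "('a, 'b) inv_poset_scheme \<Rightarrow> 'a \<Rightarrow> bool" where
  "coatom L a \<longleftrightarrow> a \<in> carrier L \<and> a \<noteq> \<one>\<^bsub>L\<^esub> \<and>
    (\<forall>x \<in> carrier L. a \<sqsubseteq>\<^bsub>L\<^esub> x \<longrightarrow> x = \<one>\<^bsub>L\<^esub> \<or> x = a)"

text \<open>The defining conditions of Kleene lattices are inherited by every subset of a Kleene lattice
  that is closed under the operations, so closure is all that a subalgebra has to satisfy. In a
  finite Kleene lattice every subalgebra is moreover atomic.\<close>

definition kleene_subalgebra :: "'a set \<Rightarrow> ('a, 'b) inv_poset_scheme \<Rightarrow> bool" where
  "kleene_subalgebra S L \<longleftrightarrow> S \<subseteq> carrier L \<and> \<zero>\<^bsub>L\<^esub> \<in> S \<and> \<one>\<^bsub>L\<^esub> \<in> S \<and>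
    (\<forall>x \<in> S. x\<acute>\<^bsub>L\<^esub> \<in> S) \<and>
    (\<forall>x \<in> S. \<forall>y \<in> S. x \<sqinter>\<^bsub>L\<^esub> y \<in> S \<and> x \<squnion>\<^bsub>L\<^esub> y \<in> S)"

text \<open>The index set is required to be nonempty: the amalgam of an empty family would be empty and
  hence not a bounded poset.\<close>

locale pasted_family =
  fixes I :: "'i set" and K :: "'i \<Rightarrow> 'a inv_poset"
  assumes index_nonempty: "I \<noteq> {}"
    and member_kleene: "i \<in> I \<Longrightarrow> kleene_lattice (K i)"
    and finite_carrier: "i \<in> I \<Longrightarrow> finite (carrier (K i))"
    and same_zer: "\<lbrakk>i \<in> I; j \<in> I\<rbrakk> \<Longrightarrow> \<zero>\<^bsub>K i\<^esub> = \<zero>\<^bsub>K j\<^esub>"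
    and same_uno: "\<lbrakk>i \<in> I; j \<in> I\<rbrakk> \<Longrightarrow> \<one>\<^bsub>K i\<^esub> = \<one>\<^bsub>K j\<^esub>"
    and card_carrier: "i \<in> I \<Longrightarrow> card (carrier (K i)) \<ge> 6"
    and inter_subalgebra: "\<lbrakk>i \<in> I; j \<in> I; i \<noteq> j\<rbrakk> \<Longrightarrow>
      carrier (K i) \<inter> carrier (K j) = {\<zero>\<^bsub>K i\<^esub>, \<one>\<^bsub>K i\<^esub>} \<or>
      (kleene_subalgebra (carrier (K i) \<inter> carrier (K j)) (K i) \<and>
       kleene_subalgebra (carrier (K i) \<inter> carrier (K j)) (K j) \<and>
       (\<forall>x \<in> carrier (K i) \<inter> carrier (K j). x\<acute>\<^bsub>K i\<^esub> = x\<acute>\<^bsub>K j\<^esub>) \<and>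
       (\<forall>x \<in> carrier (K i) \<inter> carrier (K j). \<forall>y \<in> carrier (K i) \<inter> carrier (K j).
          x \<sqinter>\<^bsub>K i\<^esub> y = x \<sqinter>\<^bsub>K j\<^esub> y \<and> x \<squnion>\<^bsub>K i\<^esub> y = x \<squnion>\<^bsub>K j\<^esub> y))"
    and card_inter: "\<lbrakk>i \<in> I; j \<in> I; i \<noteq> j\<rbrakk> \<Longrightarrow> card (carrier (K i) \<inter> carrier (K j)) \<le> 4"
    and inter_atom_coatom:
      "\<lbrakk>i \<in> I; j \<in> I; i \<noteq> j; x \<in> (carrier (K i) \<inter> carrier (K j)) - {\<zero>\<^bsub>K i\<^esub>, \<one>\<^bsub>K i\<^esub>}\<rbrakk> \<Longrightarrow>
        (atom (K i) x \<and> atom (K j) x) \<or> (coatom (K i) x \<and> coatom (K j) x)"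

text \<open>In a pasted family the members agree on the involution, \<open>\<zero>\<close> and \<open>\<one>\<close> wherever they overlap,
  so the choices of \<open>i\<close> below do not matter.\<close>

definition atomic_amalgam :: "'i set \<Rightarrow> ('i \<Rightarrow> 'a inv_poset) \<Rightarrow> 'a inv_poset" where
  "atomic_amalgam I K =
    \<lparr> carrier = (\<Union>i \<in> I. carrier (K i)),
      eq = (=),
      le = (\<lambda>x y. \<exists>i \<in> I. x \<in> carrier (K i) \<and> y \<in> carrier (K i) \<and> x \<sqsubseteq>\<^bsub>K i\<^esub> y),
      invol = (\<lambda>x. x\<acute>\<^bsub>K (SOME i. i \<in> I \<and> x \<in> carrier (K i))\<^esub>),
      zer = \<zero>\<^bsub>K (SOME i. i \<in> I)\<^esub>,
      uno = \<one>\<^bsub>K (SOME i. i \<in> I)\<^esub> \<rparr>"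

text \<open>The sequence \<open>s 1, \<dots>, s n\<close> of indices represents the candidate loop. Its members are pairwise
  distinct as a consequence of the cardinality conditions, because every member of a pasted family
  has at least six elements.\<close>

definition atomic_loop :: "'i set \<Rightarrow> ('i \<Rightarrow> 'a inv_poset) \<Rightarrow> nat \<Rightarrow> (nat \<Rightarrow> 'i) \<Rightarrow> bool" where
  "atomic_loop I K n s \<longleftrightarrow>
    n \<ge> 3 \<and> (\<forall>j \<in> {1..n}. s j \<in> I) \<and>
    (\<forall>j. 1 \<le> j \<and> j < n \<longrightarrow> card (carrier (K (s j)) \<inter> carrier (K (s (j + 1)))) = 4) \<and>
    card (carrier (K (s n)) \<inter> carrier (K (s 1))) = 4 \<and>
    (\<forall>j \<in> {1..n}. \<forall>k \<in> {1..n}.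
       j \<noteq> k \<and> k \<noteq> j + 1 \<and> j \<noteq> k + 1 \<and> {j, k} \<noteq> {1, n} \<longrightarrow>
       carrier (K (s j)) \<inter> carrier (K (s k)) = {\<zero>\<^bsub>K (s j)\<^esub>, \<one>\<^bsub>K (s j)\<^esub>}) \<and>
    (\<forall>j k l. 1 \<le> j \<and> j < k \<and> k < l \<and> l \<le> n \<longrightarrow>
       carrier (K (s j)) \<inter> carrier (K (s k)) \<inter> carrier (K (s l)) = {\<zero>\<^bsub>K (s j)\<^esub>, \<one>\<^bsub>K (s j)\<^esub>})"

end

theory Submission
  imports Defs
begin

text \<open>
  A nontrivial overlap of two members is \<open>{\<zero>, \<one>, x, x\<acute>}\<close> with \<open>x\<close> an atom of both. Members agree on
  overlaps, so a relation of the amalgam between elements of \<open>K i\<close> already holds in \<open>K i\<close>, and the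
  amalgam always inherits paraorthomodularity; it is transitive because the elements of an overlap
  are atoms or co-atoms. Orthogonality asks that for \<open>x \<sqsubseteq> y\<acute>\<close> in \<open>K i\<close> the join computed in \<open>K i\<close> lie
  below every upper bound \<open>z\<close>. This can only fail for \<open>z \<notin> K i\<close>, with \<open>x \<sqsubseteq> z\<close> in \<open>K j\<close> and \<open>y \<sqsubseteq> z\<close>
  in \<open>K k\<close>, and then \<open>K i, K j, K k\<close> form a loop.
  Conversely, let a loop have pairwise overlaps with atoms \<open>a, b, c\<close>. Distinct atoms of a Kleene
  lattice are orthogonal, so \<open>a\<close> and \<open>c\<close>, which share a member \<open>K i\<close>, have both \<open>b\<acute> \<notin> K i\<close> and
  \<open>a \<squnion> c \<in> K i\<close> as upper bounds, and no upper bound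
  of \<open>a\<close> and \<open>c\<close> is below both of these.
\<close>

section \<open>Kleene lattices\<close>

context bounded_inv_poset
begin

lemma zer_closed: "\<zero> \<in> carrier L"
  using zer_least by (simp add: least_def)

lemma uno_closed: "\<one> \<in> carrier L"
  using uno_greatest by (simp add: greatest_def)

lemma zer_le: "x \<in> carrier L \<Longrightarrow> \<zero> \<sqsubseteq> x"
  using zer_least by (simp add: least_def)

lemma le_uno: "x \<in> carrier L \<Longrightarrow> x \<sqsubseteq> \<one>"
  using uno_greatest by (simp add: greatest_def)

lemma le_zer_eq: "x \<in> carrier L \<Longrightarrow> x \<sqsubseteq> \<zero> \<Longrightarrow> x = \<zero>"
  using zer_le zer_closed le_antisym by blast

lemma uno_le_eq: "x \<in> carrier L \<Longrightarrow> \<one> \<sqsubseteq> x \<Longrightarrow> x = \<one>"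
  using le_uno uno_closed le_antisym by blast

lemma le_invol_swap:
  assumes "x \<in> carrier L" "y \<in> carrier L" "x \<sqsubseteq> y\<acute>"
  shows "y \<sqsubseteq> x\<acute>"
  using invol_antitone[of x "y\<acute>"] assms by (simp add: invol_closed invol_invol)

lemma invol_le_swap:
  assumes "x \<in> carrier L" "y \<in> carrier L" "x\<acute> \<sqsubseteq> y"
  shows "y\<acute> \<sqsubseteq> x"
  using invol_antitone[of "x\<acute>" y] assms by (simp add: invol_closed invol_invol)

lemma invol_zer: "\<zero>\<acute> = \<one>"
  using le_invol_swap[of \<zero> "\<one>"] zer_le uno_le_eq invol_closed zer_closed uno_closed by blast

lemma invol_uno: "\<one>\<acute> = \<zero>"
  using invol_zer invol_invol zer_closed by force

lemma invol_eq_iff: "x \<in> carrier L \<Longrightarrow> y \<in> carrier L \<Longrightarrow> x\<acute> = y \<longleftrightarrow> x = y\<acute>"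
  using invol_invol by metis

lemma invol_eq_uno_iff: "x \<in> carrier L \<Longrightarrow> x\<acute> = \<one> \<longleftrightarrow> x = \<zero>"
  using invol_eq_iff[of x \<one>] uno_closed invol_uno by simp

lemma invol_eq_zer_iff: "x \<in> carrier L \<Longrightarrow> x\<acute> = \<zero> \<longleftrightarrow> x = \<one>"
  using invol_eq_iff[of x \<zero>] zer_closed invol_zer by simp

text \<open>The involution turns elements below \<open>x\<acute>\<close> into elements above
  \<open>x\<close>. This lets a shared co-atom be traded for a shared atom.\<close>

lemma coatom_invol_atom:
  assumes "coatom L x"
  shows "atom L (x\<acute>)"
proof -
  have x: "x \<in> carrier L" "x \<noteq> \<one>" and top: "\<And>y. y \<in> carrier L \<Longrightarrow> x \<sqsubseteq> y \<Longrightarrow> y = \<one> \<or> y = x"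
    using assms by (auto simp: coatom_def)
  have "y = \<zero> \<or> y = x\<acute>" if y: "y \<in> carrier L" "y \<sqsubseteq> x\<acute>" for y
  proof -
    have "x \<sqsubseteq> y\<acute>" using le_invol_swap y x by blast
    then have "y\<acute> = \<one> \<or> y\<acute> = x" using top y invol_closed by blast
    then show ?thesis using invol_eq_uno_iff invol_invol x y by auto
  qed
  moreover have "x\<acute> \<noteq> \<zero>" using x invol_eq_zer_iff by simp
  ultimately show ?thesis using x invol_closed by (simp add: atom_def)
qed

end

section \<open>Atoms and orthogonal pairs in Kleene lattices\<close>

context kleene_lattice
begin

lemma atoms_meet_zer:
  assumes "atom L a" "atom L b" "a \<noteq> b"
  shows "a \<sqinter> b = \<zero>"
proof -
  have ab: "a \<in> carrier L" "b \<in> carrier L" using assms by (auto simp: atom_def)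
  then have "a \<sqinter> b \<in> carrier L" "a \<sqinter> b \<sqsubseteq> a" "a \<sqinter> b \<sqsubseteq> b"
    using meet_closed meet_left meet_right by auto
  then show ?thesis using assms unfolding atom_def by metis
qed

lemma join_zer: "x \<in> carrier L \<Longrightarrow> \<zero> \<squnion> x = x"
  using le_iff_meet[of \<zero> x] zer_le zer_closed by blast

lemma meet_absorb: "x \<in> carrier L \<Longrightarrow> y \<in> carrier L \<Longrightarrow> x \<sqsubseteq> y \<Longrightarrow> x \<sqinter> y = x"
  using le_iff_join[of x y] by metis

text \<open>Half of De Morgan's law suffices: \<open>(x \<squnion> y)\<acute>\<close> lies below
  both involutes, hence is \<open>\<zero>\<close>.\<close>

lemma join_uno_if_invol_meet_zer:
  assumes x: "x \<in> carrier L" and y: "y \<in> carrier L" and z: "x\<acute> \<sqinter> y\<acute> = \<zero>"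
  shows "x \<squnion> y = \<one>"
proof -
  have j: "x \<squnion> y \<in> carrier L" using x y join_closed by blast
  have "(x \<squnion> y)\<acute> \<sqsubseteq> x\<acute> \<sqinter> y\<acute>"
    using meet_le[OF invol_antitone invol_antitone] join_left join_right x y j invol_closed
    by simp
  then have "(x \<squnion> y)\<acute> = \<zero>" using z le_zer_eq j invol_closed by auto
  then show ?thesis using invol_eq_zer_iff j by simp
qed

text \<open>If \<open>b\<close> were not below \<open>a\<acute>\<close>, it would meet both
  \<open>a\<close> and \<open>a\<acute>\<close> in \<open>\<zero>\<close>, and by distributivity
  also \<open>a \<squnion> a\<acute>\<close>. But then
  \<open>a \<squnion> b\<acute> = \<one>\<close> as well, which yields
  \<open>b = b \<sqinter> b\<acute>\<close>, and the Kleene inequality puts \<open>b\<close> below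
  \<open>a \<squnion> a\<acute>\<close>.\<close>

lemma atoms_orthogonal:
  assumes a: "atom L a" and b: "atom L b" and ne: "a \<noteq> b"
  shows "a \<sqsubseteq> b\<acute>"
proof (rule ccontr)
  assume nle: "\<not> a \<sqsubseteq> b\<acute>"
  have c: "a \<in> carrier L" "b \<in> carrier L" "a\<acute> \<in> carrier L" "b\<acute> \<in> carrier L"
    using a b invol_closed by (auto simp: atom_def)
  have "b \<sqinter> a\<acute> \<noteq> b"
    using nle le_invol_swap[of b a] meet_right[of b "a\<acute>"] c by metis
  then have z: "b \<sqinter> a\<acute> = \<zero>"
    using b c meet_left[of b "a\<acute>"] meet_closed unfolding atom_def by metis
  have ba: "b \<sqinter> a = \<zero>" using atoms_meet_zer b a ne by metis
  have "b \<sqinter> (a \<squnion> a\<acute>) = \<zero>"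
    using meet_join_distrib[of b a "a\<acute>"] z ba c join_zer zer_closed by simp
  moreover have "b \<sqsubseteq> a \<squnion> a\<acute>"
  proof -
    have "a \<squnion> b\<acute> = \<one>"
      using join_uno_if_invol_meet_zer[of a "b\<acute>"] z c invol_invol meet_comm by metis
    then have "b = b \<sqinter> (a \<squnion> b\<acute>)"
      using c meet_absorb[of b "\<one>"] le_uno[of b] uno_closed by simp
    also have "\<dots> = b \<sqinter> b\<acute>"
      using meet_join_distrib[of b a "b\<acute>"] ba c join_zer meet_closed by simp
    finally show ?thesis using kleene[of b a] c by simp
  qed
  ultimately show False
    using meet_absorb[of b "a \<squnion> a\<acute>"] c join_closed b by (simp add: atom_def)
qed

text \<open>Contrapositive of paraorthomodularity for \<open>x \<sqsubseteq> y\<acute>\<close>: if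
  the join were \<open>\<one>\<close>, the only common lower bound of \<open>x\<acute>\<close> and
  \<open>y\<acute>\<close> would be \<open>\<zero>\<close>.\<close>

lemma join_orthogonal_ne_uno:
  assumes x: "x \<in> carrier L" and y: "y \<in> carrier L" and le: "x \<sqsubseteq> y\<acute>" and ne: "x \<noteq> y\<acute>"
  shows "x \<squnion> y \<noteq> \<one>"
proof
  assume one: "x \<squnion> y = \<one>"
  have "l = \<zero>" if l: "l \<in> Lower L {x\<acute>, y\<acute>}" for l
  proof -
    have lc: "l \<in> carrier L" "l \<sqsubseteq> x\<acute>" "l \<sqsubseteq> y\<acute>"
      using l x y invol_closed by (auto simp: Lower_def)
    then have "x \<sqsubseteq> l\<acute>" "y \<sqsubseteq> l\<acute>"
      using le_invol_swap[of l x] le_invol_swap[of l y] x y by simp_all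
    then have "x \<squnion> y \<sqsubseteq> l\<acute>" using join_le x y lc invol_closed by simp
    then have "l\<acute> = \<one>" using one uno_le_eq lc invol_closed by auto
    then show ?thesis using invol_eq_uno_iff lc by simp
  qed
  moreover have "\<zero> \<in> Lower L {x\<acute>, y\<acute>}"
    using x y invol_closed zer_closed zer_le by (auto intro: Lower_memI)
  ultimately have "greatest L \<zero> (Lower L {x\<acute>, y\<acute>})"
    unfolding greatest_def using le_refl[OF zer_closed] by blast
  then show False using paraorthomodular[of x "y\<acute>"] x y le ne invol_closed by blast
qed

text \<open>A further element \<open>y\<close> would meet \<open>x\<close> in
  \<open>\<zero>\<close>, and so would \<open>y\<acute>\<close>; by distributivity so would
  \<open>y \<squnion> y\<acute>\<close>. Yet \<open>x = x \<sqinter> x\<acute>\<close> is below that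
  join by the Kleene inequality.\<close>

lemma carrier_self_dual_atom:
  assumes x: "atom L x" and self: "x\<acute> = x"
  shows "carrier L \<subseteq> {\<zero>, \<one>, x}"
proof
  fix y assume y: "y \<in> carrier L"
  have xc: "x \<in> carrier L" "x \<noteq> \<zero>" using x by (auto simp: atom_def)
  \<comment> \<open>Being its own involute, the atom \<open>x\<close> is a co-atom too.\<close>
  have above: "z = \<one> \<or> z = x" if "z \<in> carrier L" "x \<sqsubseteq> z" for z
  proof -
    have "z\<acute> \<sqsubseteq> x" using that xc self invol_le_swap[of x z] by simp
    then have "z\<acute> = \<zero> \<or> z\<acute> = x" using x that invol_closed by (auto simp: atom_def)
    then show ?thesis using self invol_eq_zer_iff invol_eq_iff[of z x] that xc by auto
  qed
  show "y \<in> {\<zero>, \<one>, x}"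
  proof (rule ccontr)
    assume n: "y \<notin> {\<zero>, \<one>, x}"
    have "\<not> x \<sqsubseteq> y" using above y n by blast
    moreover have "\<not> x \<sqsubseteq> y\<acute>"
    proof
      assume "x \<sqsubseteq> y\<acute>"
      then have "y\<acute> = \<one> \<or> y\<acute> = x" using above y invol_closed by blast
      then show False using n self invol_eq_uno_iff invol_eq_iff[of y x] y xc by auto
    qed
    ultimately have "x \<sqinter> y = \<zero>" "x \<sqinter> y\<acute> = \<zero>"
      using x y invol_closed meet_left meet_right meet_closed xc unfolding atom_def by metis+
    then have "x \<sqinter> (y \<squnion> y\<acute>) = \<zero>"
      using meet_join_distrib[of x y "y\<acute>"] xc y invol_closed join_zer zer_closed by simp
    moreover have "x \<sqsubseteq> y \<squnion> y\<acute>"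
      using kleene[of x y] xc y self meet_absorb[of x x] by simp
    ultimately show False
      using meet_absorb[of x "y \<squnion> y\<acute>"] xc y join_closed invol_closed by simp
  qed
qed

end

section \<open>Atomic amalgams\<close>

text \<open>Among three members every pair is cyclically adjacent, so the condition on non-adjacent
  pairs is vacuous and only one triple remains.\<close>

lemma atomic_loop_3_iff:
  "atomic_loop I K 3 s \<longleftrightarrow> s 1 \<in> I \<and> s 2 \<in> I \<and> s 3 \<in> I \<and>
    card (carrier (K (s 1)) \<inter> carrier (K (s 2))) = 4 \<and>
    card (carrier (K (s 2)) \<inter> carrier (K (s 3))) = 4 \<and>
    card (carrier (K (s 3)) \<inter> carrier (K (s 1))) = 4 \<and>
    carrier (K (s 1)) \<inter> carrier (K (s 2)) \<inter> carrier (K (s 3)) = {\<zero>\<^bsub>K (s 1)\<^esub>, \<one>\<^bsub>K (s 1)\<^esub>}"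
proof -
  have I: "{1..3} = {1, 2, 3 :: nat}" by auto
  have two: "(\<forall>j. 1 \<le> j \<and> j < 3 \<longrightarrow> P j) \<longleftrightarrow> P 1 \<and> P 2" for P :: "nat \<Rightarrow> bool"
  proof -
    have "1 \<le> j \<and> j < 3 \<longleftrightarrow> j = 1 \<or> j = 2" for j :: nat by auto
    then show ?thesis by metis
  qed
  have three: "1 \<le> j \<and> j < k \<and> k < l \<and> l \<le> 3 \<longleftrightarrow> j = 1 \<and> k = 2 \<and> l = 3" for j k l :: nat
    by auto
  show ?thesis
    unfolding atomic_loop_def I two three by (simp add: insert_commute numeral_2_eq_2[symmetric])
qed

section \<open>Agreement of the members on their overlaps\<close>

context pasted_family
begin

abbreviation A :: "'a inv_poset" where "A \<equiv> atomic_amalgam I K"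

abbreviation C :: "'i \<Rightarrow> 'a set" where "C i \<equiv> carrier (K i)"

lemma carrier_A: "carrier A = (\<Union>i \<in> I. C i)"
  by (simp add: atomic_amalgam_def)

lemma le_A: "x \<sqsubseteq>\<^bsub>A\<^esub> y \<longleftrightarrow> (\<exists>i \<in> I. x \<in> C i \<and> y \<in> C i \<and> x \<sqsubseteq>\<^bsub>K i\<^esub> y)"
  by (simp add: atomic_amalgam_def)

lemma zer_K:
  assumes "i \<in> I"
  shows "\<zero>\<^bsub>K i\<^esub> = \<zero>\<^bsub>A\<^esub>"
  using same_zer[OF assms someI[of "\<lambda>i. i \<in> I", OF assms]] by (simp add: atomic_amalgam_def)

lemma uno_K:
  assumes "i \<in> I"
  shows "\<one>\<^bsub>K i\<^esub> = \<one>\<^bsub>A\<^esub>"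
  using same_uno[OF assms someI[of "\<lambda>i. i \<in> I", OF assms]] by (simp add: atomic_amalgam_def)

lemma zer_uno_in:
  assumes "i \<in> I"
  shows "\<zero>\<^bsub>A\<^esub> \<in> C i" "\<one>\<^bsub>A\<^esub> \<in> C i"
proof -
  interpret kleene_lattice "K i" using assms by (rule member_kleene)
  show "\<zero>\<^bsub>A\<^esub> \<in> C i" "\<one>\<^bsub>A\<^esub> \<in> C i"
    using zer_closed uno_closed zer_K uno_K assms by auto
qed

text \<open>For an overlap \<open>{\<zero>, \<one>}\<close> the axiom
  \<open>inter_subalgebra\<close> says nothing about the involution, but there its values are
  forced.\<close>

lemma overlap_invol:
  assumes i: "i \<in> I" and j: "j \<in> I" and x: "x \<in> C i" "x \<in> C j"
  shows "x\<acute>\<^bsub>K i\<^esub> = x\<acute>\<^bsub>K j\<^esub>"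
proof -
  interpret Ki: kleene_lattice "K i" using i by (rule member_kleene)
  interpret Kj: kleene_lattice "K j" using j by (rule member_kleene)
  show ?thesis
  proof (cases "i = j \<or> C i \<inter> C j = {\<zero>\<^bsub>K i\<^esub>, \<one>\<^bsub>K i\<^esub>}")
    case True
    then have "i = j \<or> x = \<zero>\<^bsub>K i\<^esub> \<or> x = \<one>\<^bsub>K i\<^esub>" using x by blast
    then show ?thesis
      using zer_K uno_K i j Ki.invol_zer Ki.invol_uno Kj.invol_zer Kj.invol_uno by metis
  next
    case False
    then show ?thesis using inter_subalgebra[OF i j] x by blast
  qed
qed

lemma invol_K:
  assumes "i \<in> I" "x \<in> C i"
  shows "x\<acute>\<^bsub>K i\<^esub> = x\<acute>\<^bsub>A\<^esub>"
proof -
  have "(SOME i. i \<in> I \<and> x \<in> C i) \<in> I \<and> x \<in> C (SOME i. i \<in> I \<and> x \<in> C i)"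
    using someI[of "\<lambda>i. i \<in> I \<and> x \<in> C i" i] assms by blast
  then have "x\<acute>\<^bsub>K i\<^esub> = x\<acute>\<^bsub>K (SOME i. i \<in> I \<and> x \<in> C i)\<^esub>"
    using overlap_invol assms by blast
  then show ?thesis by (simp add: atomic_amalgam_def)
qed

lemma invol_in:
  assumes "i \<in> I" "x \<in> C i"
  shows "x\<acute>\<^bsub>A\<^esub> \<in> C i"
proof -
  interpret kleene_lattice "K i" using assms by (intro member_kleene)
  show ?thesis using invol_closed assms invol_K by metis
qed

text \<open>Joins carry the comparison of orders in \<open>le_K\<close>. As for the involution, a
  trivial overlap is treated by hand.\<close>

lemma overlap_join:
  assumes i: "i \<in> I" and j: "j \<in> I" and x: "x \<in> C i \<inter> C j" and y: "y \<in> C i \<inter> C j"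
  shows "x \<squnion>\<^bsub>K i\<^esub> y = x \<squnion>\<^bsub>K j\<^esub> y"
proof -
  interpret Ki: kleene_lattice "K i" using i by (rule member_kleene)
  interpret Kj: kleene_lattice "K j" using j by (rule member_kleene)
  show ?thesis
  proof (cases "i = j \<or> C i \<inter> C j = {\<zero>\<^bsub>K i\<^esub>, \<one>\<^bsub>K i\<^esub>}")
    case True
    have z: "\<zero>\<^bsub>K i\<^esub> = \<zero>\<^bsub>K j\<^esub>" "\<one>\<^bsub>K i\<^esub> = \<one>\<^bsub>K j\<^esub>" using same_zer same_uno i j by blast+
    have "i = j \<or> x \<in> {\<zero>\<^bsub>K i\<^esub>, \<one>\<^bsub>K i\<^esub>} \<and> y \<in> {\<zero>\<^bsub>K i\<^esub>, \<one>\<^bsub>K i\<^esub>}" using True x y by blast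
    moreover have "x \<squnion>\<^bsub>K i\<^esub> y = x \<squnion>\<^bsub>K j\<^esub> y" if "x = \<zero>\<^bsub>K i\<^esub>"
      using that Ki.join_zer Kj.join_zer y z by simp
    moreover have "x \<squnion>\<^bsub>K i\<^esub> y = x \<squnion>\<^bsub>K j\<^esub> y" if "y = \<zero>\<^bsub>K i\<^esub>"
      using that Ki.join_zer[of x] Kj.join_zer[of x] x z
        join_comm[of "K i" x y] join_comm[of "K j" x y] by simp
    moreover have "\<one>\<^bsub>K i\<^esub> \<squnion>\<^bsub>K i\<^esub> \<one>\<^bsub>K i\<^esub> = \<one>\<^bsub>K i\<^esub>" "\<one>\<^bsub>K j\<^esub> \<squnion>\<^bsub>K j\<^esub> \<one>\<^bsub>K j\<^esub> = \<one>\<^bsub>K j\<^esub>"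
      using Ki.le_iff_meet Kj.le_iff_meet Ki.uno_closed Kj.uno_closed Ki.le_refl Kj.le_refl by blast+
    ultimately show ?thesis using z by auto
  next
    case False
    then show ?thesis using inter_subalgebra[OF i j] x y by blast
  qed
qed

text \<open>Here \<open>le_iff_meet\<close> characterizes \<open>x \<sqsubseteq> y\<close> by
  \<open>x \<squnion> y = y\<close>, so agreement of joins carries the relation from any witnessing
  member into \<open>K i\<close>.\<close>

lemma le_K:
  assumes i: "i \<in> I" and x: "x \<in> C i" and y: "y \<in> C i"
  shows "x \<sqsubseteq>\<^bsub>A\<^esub> y \<longleftrightarrow> x \<sqsubseteq>\<^bsub>K i\<^esub> y"
proof -
  interpret Ki: kleene_lattice "K i" using i by (rule member_kleene)
  have "x \<sqsubseteq>\<^bsub>K i\<^esub> y" if j: "j \<in> I" "x \<in> C j" "y \<in> C j" "x \<sqsubseteq>\<^bsub>K j\<^esub> y" for j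
  proof -
    interpret Kj: kleene_lattice "K j" using j(1) by (rule member_kleene)
    show ?thesis
      using overlap_join[of i j x y] i x y j Ki.le_iff_meet Kj.le_iff_meet by simp
  qed
  then show ?thesis using i x y unfolding le_A by blast
qed

section \<open>The shape of nontrivial overlaps\<close>

lemma zer_ne_uno: "\<zero>\<^bsub>A\<^esub> \<noteq> \<one>\<^bsub>A\<^esub>"
proof
  assume eq: "\<zero>\<^bsub>A\<^esub> = \<one>\<^bsub>A\<^esub>"
  obtain i where i: "i \<in> I" using index_nonempty by blast
  interpret kleene_lattice "K i" using i by (rule member_kleene)
  have "C i \<subseteq> {\<zero>\<^bsub>A\<^esub>}" using eq zer_K uno_K i le_uno le_zer_eq by force
  then have "card (C i) \<le> 1" using card_mono[of "{\<zero>\<^bsub>A\<^esub>}"] by fastforce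
  then show False using card_carrier[OF i] by simp
qed

text \<open>A self-dual atom would leave \<open>K i\<close> with at most three elements instead of
  six or more.\<close>

lemma atom_ne_invol:
  assumes i: "i \<in> I" and x: "atom (K i) x"
  shows "x\<acute>\<^bsub>K i\<^esub> \<noteq> x"
proof
  assume eq: "x\<acute>\<^bsub>K i\<^esub> = x"
  interpret kleene_lattice "K i" using i by (rule member_kleene)
  have "C i \<subseteq> {\<zero>\<^bsub>K i\<^esub>, \<one>\<^bsub>K i\<^esub>, x}" using carrier_self_dual_atom x eq by blast
  then have "card (C i) \<le> card {\<zero>\<^bsub>K i\<^esub>, \<one>\<^bsub>K i\<^esub>, x}" by (intro card_mono) auto
  also have "\<dots> \<le> 3" by (simp add: card_insert_if)
  finally show False using card_carrier[OF i] by simp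
qed

lemma overlap_extremal:
  assumes "i \<in> I" "j \<in> I" "i \<noteq> j" "x \<in> C i" "x \<in> C j" "x \<noteq> \<zero>\<^bsub>A\<^esub>" "x \<noteq> \<one>\<^bsub>A\<^esub>"
  shows "(atom (K i) x \<and> atom (K j) x) \<or> (coatom (K i) x \<and> coatom (K j) x)"
  using inter_atom_coatom[of i j x] assms zer_K uno_K by simp

text \<open>The four listed elements are distinct, and an overlap has no more than four. That
  \<open>x\<close> differs from its involute follows from \<open>atom_ne_invol\<close>, since one of
  the two is an atom.\<close>

lemma overlap_eq:
  assumes i: "i \<in> I" and j: "j \<in> I" and ne: "i \<noteq> j"
    and x: "x \<in> C i" "x \<in> C j" "x \<noteq> \<zero>\<^bsub>A\<^esub>" "x \<noteq> \<one>\<^bsub>A\<^esub>"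
  shows "C i \<inter> C j = {\<zero>\<^bsub>A\<^esub>, \<one>\<^bsub>A\<^esub>, x, x\<acute>\<^bsub>A\<^esub>}" and "card (C i \<inter> C j) = 4"
proof -
  interpret kleene_lattice "K i" using i by (rule member_kleene)
  let ?S = "{\<zero>\<^bsub>A\<^esub>, \<one>\<^bsub>A\<^esub>, x, x\<acute>\<^bsub>A\<^esub>}"
  have "x\<acute>\<^bsub>A\<^esub> \<noteq> x"
    using overlap_extremal[OF i j ne x] atom_ne_invol[OF i] coatom_invol_atom invol_K[OF i] x(1)
      invol_eq_iff invol_in[OF i] by metis
  moreover have "x\<acute>\<^bsub>A\<^esub> \<noteq> \<zero>\<^bsub>A\<^esub>" "x\<acute>\<^bsub>A\<^esub> \<noteq> \<one>\<^bsub>A\<^esub>"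
    using invol_K[OF i x(1)] invol_eq_zer_iff[OF x(1)] invol_eq_uno_iff[OF x(1)]
      zer_K[OF i] uno_K[OF i] x by auto
  ultimately have c: "card ?S = 4" using x zer_ne_uno by auto
  have sub: "?S \<subseteq> C i \<inter> C j" using x invol_in i j zer_uno_in by blast
  have fin: "finite (C i \<inter> C j)" using finite_carrier i by blast
  show "C i \<inter> C j = ?S" using card_seteq[OF fin sub] c card_inter[OF i j ne] by simp
  then show "card (C i \<inter> C j) = 4" using c by simp
qed

section \<open>Order axioms and paraorthomodularity of the amalgam\<close>

lemma amalgam_bounded_inv_poset: "bounded_inv_poset A"
proof
  show "x .=\<^bsub>A\<^esub> x" for x by (simp add: atomic_amalgam_def)
  show "y .=\<^bsub>A\<^esub> x" if "x .=\<^bsub>A\<^esub> y" for x y using that by (simp add: atomic_amalgam_def)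
  show "x .=\<^bsub>A\<^esub> z" if "x .=\<^bsub>A\<^esub> y" "y .=\<^bsub>A\<^esub> z" for x y z
    using that by (simp add: atomic_amalgam_def)
  show "(.=\<^bsub>A\<^esub>) = (=)" by (simp add: atomic_amalgam_def)
  show "x \<sqsubseteq>\<^bsub>A\<^esub> z \<longleftrightarrow> y \<sqsubseteq>\<^bsub>A\<^esub> w" if "x .=\<^bsub>A\<^esub> y" "z .=\<^bsub>A\<^esub> w" for x y z w
    using that by (simp add: atomic_amalgam_def)
  show "x \<sqsubseteq>\<^bsub>A\<^esub> x" if "x \<in> carrier A" for x
  proof -
    obtain i where i: "i \<in> I" "x \<in> C i" using \<open>x \<in> carrier A\<close> carrier_A by blast
    interpret kleene_lattice "K i" using i by (intro member_kleene)
    show ?thesis using le_refl le_A i by blast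
  qed
  show "x .=\<^bsub>A\<^esub> y" if xy: "x \<sqsubseteq>\<^bsub>A\<^esub> y" "y \<sqsubseteq>\<^bsub>A\<^esub> x" for x y
  proof -
    obtain i where i: "i \<in> I" "x \<in> C i" "y \<in> C i" using xy le_A by blast
    interpret kleene_lattice "K i" using i by (intro member_kleene)
    show ?thesis using le_antisym[of x y] le_K i xy by (simp add: atomic_amalgam_def)
  qed
  show "x \<sqsubseteq>\<^bsub>A\<^esub> z" if xyz: "x \<sqsubseteq>\<^bsub>A\<^esub> y" "y \<sqsubseteq>\<^bsub>A\<^esub> z" for x y z
  proof -
    obtain i where i: "i \<in> I" "x \<in> C i" "y \<in> C i" "x \<sqsubseteq>\<^bsub>K i\<^esub> y" using xyz le_A by blast
    obtain j where j: "j \<in> I" "y \<in> C j" "z \<in> C j" "y \<sqsubseteq>\<^bsub>K j\<^esub> z" using xyz le_A by blast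
    interpret Ki: kleene_lattice "K i" using i by (intro member_kleene)
    interpret Kj: kleene_lattice "K j" using j by (intro member_kleene)
    \<comment> \<open>The middle element \<open>y\<close> lies in both members. An atom of
      \<open>K i\<close> has only \<open>\<zero>\<close> and itself below it, a co-atom of
      \<open>K j\<close> only \<open>\<one>\<close> and itself above it, so one of the two relations
      degenerates.\<close>
    consider "i = j" | "y = \<zero>\<^bsub>A\<^esub>" | "y = \<one>\<^bsub>A\<^esub>" | "atom (K i) y" | "coatom (K j) y"
      using overlap_extremal i j by blast
    then show ?thesis
    proof cases
      case 1
      then show ?thesis using Ki.le_trans i j le_A by blast
    next
      case 2
      then have "x = y" using Ki.le_zer_eq i zer_K by metis
      then show ?thesis using xyz by simp
    next
      case 3
      then have "z = y" using Kj.uno_le_eq j uno_K by metis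
      then show ?thesis using xyz by simp
    next
      case 4
      then have "x = \<zero>\<^bsub>K j\<^esub> \<or> x = y" using i zer_K j by (auto simp: atom_def)
      then show ?thesis using Kj.zer_le Kj.zer_closed j le_A xyz by blast
    next
      case 5
      then have "z = \<one>\<^bsub>K i\<^esub> \<or> z = y" using j uno_K i by (auto simp: coatom_def)
      then show ?thesis using Ki.le_uno Ki.uno_closed i le_A xyz by blast
    qed
  qed
  show "least A \<zero>\<^bsub>A\<^esub> (carrier A)"
    unfolding least_def
  proof (intro conjI ballI)
    show "\<zero>\<^bsub>A\<^esub> \<in> carrier A" using index_nonempty zer_uno_in carrier_A by blast
    fix x assume "x \<in> carrier A"
    then obtain i where i: "i \<in> I" "x \<in> C i" using carrier_A by blast
    interpret kleene_lattice "K i" using i by (intro member_kleene)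
    show "\<zero>\<^bsub>A\<^esub> \<sqsubseteq>\<^bsub>A\<^esub> x" using zer_le zer_closed le_A i zer_K by metis
  qed simp
  show "greatest A \<one>\<^bsub>A\<^esub> (carrier A)"
    unfolding greatest_def
  proof (intro conjI ballI)
    show "\<one>\<^bsub>A\<^esub> \<in> carrier A" using index_nonempty zer_uno_in carrier_A by blast
    fix x assume "x \<in> carrier A"
    then obtain i where i: "i \<in> I" "x \<in> C i" using carrier_A by blast
    interpret kleene_lattice "K i" using i by (intro member_kleene)
    show "x \<sqsubseteq>\<^bsub>A\<^esub> \<one>\<^bsub>A\<^esub>" using le_uno uno_closed le_A i uno_K by metis
  qed simp
  show "x\<acute>\<^bsub>A\<^esub> \<in> carrier A" if "x \<in> carrier A" for x
    using that carrier_A invol_in by blast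
  show "x\<acute>\<^bsub>A\<^esub>\<acute>\<^bsub>A\<^esub> = x" if "x \<in> carrier A" for x
  proof -
    obtain i where i: "i \<in> I" "x \<in> C i" using \<open>x \<in> carrier A\<close> carrier_A by blast
    interpret kleene_lattice "K i" using i by (intro member_kleene)
    show ?thesis using invol_invol invol_K invol_in i by metis
  qed
  show "y\<acute>\<^bsub>A\<^esub> \<sqsubseteq>\<^bsub>A\<^esub> x\<acute>\<^bsub>A\<^esub>" if xy: "x \<sqsubseteq>\<^bsub>A\<^esub> y" for x y
  proof -
    obtain i where i: "i \<in> I" "x \<in> C i" "y \<in> C i" using xy le_A by blast
    interpret kleene_lattice "K i" using i by (intro member_kleene)
    show ?thesis using invol_antitone invol_K invol_in le_K i xy by metis
  qed
qed

text \<open>Lower bounds in \<open>K i\<close> remain lower bounds in the amalgam, so an infimum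
  \<open>\<zero>\<close> in the amalgam is one in \<open>K i\<close>, where paraorthomodularity is
  available.\<close>

lemma amalgam_paraorthomodular: "paraorthomodular_poset A"
proof -
  interpret A: bounded_inv_poset A by (rule amalgam_bounded_inv_poset)
  show ?thesis
  proof
    fix x y
    assume le: "x \<sqsubseteq>\<^bsub>A\<^esub> y" and g: "greatest A \<zero>\<^bsub>A\<^esub> (Lower A {x\<acute>\<^bsub>A\<^esub>, y})"
    obtain i where i: "i \<in> I" "x \<in> C i" "y \<in> C i" using le le_A by blast
    interpret kleene_lattice "K i" using i by (intro member_kleene)
    have "l \<sqsubseteq>\<^bsub>K i\<^esub> \<zero>\<^bsub>K i\<^esub>" if l: "l \<in> Lower (K i) {x\<acute>\<^bsub>K i\<^esub>, y}" for l
    proof -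
      have lc: "l \<in> C i" "l \<sqsubseteq>\<^bsub>K i\<^esub> x\<acute>\<^bsub>K i\<^esub>" "l \<sqsubseteq>\<^bsub>K i\<^esub> y"
        using l i invol_closed by (auto simp: Lower_def)
      then have "l \<sqsubseteq>\<^bsub>A\<^esub> x\<acute>\<^bsub>A\<^esub>" "l \<sqsubseteq>\<^bsub>A\<^esub> y"
        using le_K i invol_in invol_K by auto
      then have "l \<in> Lower A {x\<acute>\<^bsub>A\<^esub>, y}"
        using lc i carrier_A by (auto intro!: Lower_memI)
      then have "l \<sqsubseteq>\<^bsub>A\<^esub> \<zero>\<^bsub>A\<^esub>" using g by (simp add: greatest_def)
      then show ?thesis using le_K lc i zer_uno_in zer_K by metis
    qed
    then have "greatest (K i) \<zero>\<^bsub>K i\<^esub> (Lower (K i) {x\<acute>\<^bsub>K i\<^esub>, y})"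
      using zer_closed zer_le i invol_closed by (auto simp: greatest_def intro: Lower_memI)
    then show "x = y" using paraorthomodular i le le_K by blast
  qed
qed

section \<open>Orthogonality in the absence of loops\<close>

lemma orthogonal_if_no_loop:
  assumes noloop: "\<not> (\<exists>s. atomic_loop I K 3 s)"
  shows "orthogonal_poset A"
proof -
  interpret A: bounded_inv_poset A by (rule amalgam_bounded_inv_poset)
  show ?thesis
  proof
    fix x y
    assume yc: "y \<in> carrier A" and le: "x \<sqsubseteq>\<^bsub>A\<^esub> y\<acute>\<^bsub>A\<^esub>"
    obtain i where i: "i \<in> I" "x \<in> C i" "y\<acute>\<^bsub>A\<^esub> \<in> C i" using le le_A by blast
    then have y: "y \<in> C i" using invol_in[of i "y\<acute>\<^bsub>A\<^esub>"] A.invol_invol[OF yc] by simp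
    interpret Ki: kleene_lattice "K i" using i by (intro member_kleene)
    let ?s = "x \<squnion>\<^bsub>K i\<^esub> y"
    have s: "?s \<in> C i" "x \<sqsubseteq>\<^bsub>K i\<^esub> ?s" "y \<sqsubseteq>\<^bsub>K i\<^esub> ?s"
      using i y Ki.join_closed Ki.join_left Ki.join_right by auto
    have "?s \<sqsubseteq>\<^bsub>A\<^esub> z" if z: "x \<sqsubseteq>\<^bsub>A\<^esub> z" "y \<sqsubseteq>\<^bsub>A\<^esub> z" for z
    proof (rule ccontr)
      assume n: "\<not> ?s \<sqsubseteq>\<^bsub>A\<^esub> z"
      obtain j where j: "j \<in> I" "x \<in> C j" "z \<in> C j" "x \<sqsubseteq>\<^bsub>K j\<^esub> z" using z le_A by blast
      obtain k where k: "k \<in> I" "y \<in> C k" "z \<in> C k" "y \<sqsubseteq>\<^bsub>K k\<^esub> z" using z le_A by blast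
      interpret Kj: kleene_lattice "K j" using j by (intro member_kleene)
      interpret Kk: kleene_lattice "K k" using k by (intro member_kleene)
      have zi: "z \<notin> C i"
        using n z le_K i s y Ki.join_le by metis
      \<comment> \<open>With a single member \<open>K j\<close> containing \<open>x\<close>,
        \<open>y\<close> and \<open>z\<close>, the join in \<open>K j\<close> is below
        \<open>z\<close> and equals \<open>?s\<close>.\<close>
      have jk: "j \<noteq> k"
      proof
        assume "j = k"
        then have "?s \<sqsubseteq>\<^bsub>K j\<^esub> z" "?s \<in> C j"
          using overlap_join[of i j x y] i j k y Kj.join_le Kj.join_closed by auto
        then show False using n j le_A by blast
      qed
      \<comment> \<open>Next, \<open>x\<close>, \<open>y\<close> and \<open>z\<close> are shown to
        be nontrivial, so that they witness overlaps of size four: \<open>x\<close> for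
        \<open>i, j\<close>, \<open>y\<close> for \<open>k, i\<close>, \<open>z\<close> for
        \<open>j, k\<close>.\<close>
      have zn: "z \<noteq> \<zero>\<^bsub>A\<^esub>" "z \<noteq> \<one>\<^bsub>A\<^esub>" using zi zer_uno_in i by blast+
      have x1: "x \<noteq> \<one>\<^bsub>A\<^esub>" using Kj.uno_le_eq j uno_K zn by metis
      have y1: "y \<noteq> \<one>\<^bsub>A\<^esub>" using Kk.uno_le_eq k uno_K zn by metis
      have x0: "x \<noteq> \<zero>\<^bsub>A\<^esub>" using Ki.join_zer y zer_K i n z by metis
      have y0: "y \<noteq> \<zero>\<^bsub>A\<^esub>" using Ki.join_zer[of x] zer_K i n z join_comm[of "K i" x y] by metis
      have ij: "i \<noteq> j" "i \<noteq> k" using zi j k by blast+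
      \<comment> \<open>A nontrivial common element would determine both
        \<open>C i \<inter> C j\<close> and \<open>C j \<inter> C k\<close>, making them equal and
        bringing \<open>z\<close> into \<open>C i\<close>.\<close>
      have triv: "w = \<zero>\<^bsub>A\<^esub> \<or> w = \<one>\<^bsub>A\<^esub>" if w: "w \<in> C i" "w \<in> C j" "w \<in> C k" for w
      proof (rule ccontr)
        assume "\<not> ?thesis"
        then have "C i \<inter> C j = C j \<inter> C k"
          using overlap_eq(1)[of i j w] overlap_eq(1)[of j k w] w i j k ij jk by simp
        then show False using zi j k by blast
      qed
      let ?m = "\<lambda>m :: nat. if m = 1 then i else if m = 2 then j else k"
      have "C i \<inter> C j \<inter> C k = {\<zero>\<^bsub>K i\<^esub>, \<one>\<^bsub>K i\<^esub>}"
        using triv zer_uno_in zer_K uno_K i j k by auto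
      moreover have "card (C i \<inter> C j) = 4" using overlap_eq(2)[of i j x] i j ij x0 x1 by simp
      moreover have "card (C j \<inter> C k) = 4" using overlap_eq(2)[of j k z] j k jk zn by simp
      moreover have "card (C k \<inter> C i) = 4" using overlap_eq(2)[of k i y] k i y ij y0 y1 by simp
      ultimately have "atomic_loop I K 3 ?m"
        using i j k by (simp add: atomic_loop_3_iff)
      then show False using noloop by blast
    qed
    moreover have s_A: "x \<sqsubseteq>\<^bsub>A\<^esub> ?s" "y \<sqsubseteq>\<^bsub>A\<^esub> ?s" "{x, y} \<subseteq> carrier A"
      using s i y le_K carrier_A by auto
    moreover have s_in: "?s \<in> carrier A" using s(1) i(1) carrier_A by blast
    ultimately have "?s \<sqsubseteq>\<^bsub>A\<^esub> z" if "z \<in> Upper A {x, y}" for z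
      using that Upper_memD[OF that _ s_A(3)] by simp
    then have "least A ?s (Upper A {x, y})"
      using s_A s_in by (intro least_UpperI) auto
    then show "\<exists>s. least A s (Upper A {x, y})" by blast
  qed
qed

section \<open>Failure of orthogonality in the presence of a loop\<close>

text \<open>Four elements leave room for one besides \<open>\<zero>\<close> and
  \<open>\<one>\<close>. If it is a co-atom of both members, its common involute is an atom of
  both.\<close>

lemma overlap_atom:
  assumes i: "i \<in> I" and j: "j \<in> I" and ne: "i \<noteq> j" and c: "card (C i \<inter> C j) = 4"
  obtains a where "atom (K i) a" "atom (K j) a"
    "a \<in> C i" "a \<in> C j" "a \<noteq> \<zero>\<^bsub>A\<^esub>" "a \<noteq> \<one>\<^bsub>A\<^esub>"
proof -
  interpret Ki: kleene_lattice "K i" using i by (rule member_kleene)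
  interpret Kj: kleene_lattice "K j" using j by (rule member_kleene)
  have "\<not> C i \<inter> C j \<subseteq> {\<zero>\<^bsub>A\<^esub>, \<one>\<^bsub>A\<^esub>}"
  proof
    assume "C i \<inter> C j \<subseteq> {\<zero>\<^bsub>A\<^esub>, \<one>\<^bsub>A\<^esub>}"
    then have "card (C i \<inter> C j) \<le> card {\<zero>\<^bsub>A\<^esub>, \<one>\<^bsub>A\<^esub>}" by (intro card_mono) auto
    also have "\<dots> \<le> 2" by (simp add: card_insert_if)
    finally show False using c by simp
  qed
  then obtain x where x: "x \<in> C i" "x \<in> C j" "x \<noteq> \<zero>\<^bsub>A\<^esub>" "x \<noteq> \<one>\<^bsub>A\<^esub>" by blast
  have "\<exists>a. atom (K i) a \<and> atom (K j) a"
    using overlap_extremal[OF i j ne x] Ki.coatom_invol_atom Kj.coatom_invol_atom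
      invol_K[OF i x(1)] invol_K[OF j x(2)] by metis
  then obtain a where a: "atom (K i) a" "atom (K j) a" by blast
  have "a \<noteq> \<one>\<^bsub>A\<^esub>"
  proof
    assume one: "a = \<one>\<^bsub>A\<^esub>"
    have "x \<sqsubseteq>\<^bsub>K i\<^esub> a" using one x Ki.le_uno uno_K i by metis
    then show False using a x one zer_K[OF i] by (auto simp: atom_def)
  qed
  then show thesis using that a zer_K[OF i] by (auto simp: atom_def)
qed

text \<open>A supremum \<open>u\<close> of \<open>a\<close> and \<open>c\<close> would lie below
  \<open>t = a \<squnion> c\<close>, which forces \<open>u\<close> into \<open>K i\<close>, and
  below \<open>d = b\<acute>\<close>, which is outside \<open>K i\<close>. So \<open>u\<close> would
  be shared by \<open>K i\<close> and another member, hence be an atom or a co-atom of both, and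
  neither is possible.\<close>

lemma not_orthogonal_if_loop:
  assumes loop: "atomic_loop I K 3 s" and orth: "orthogonal_poset A"
  shows False
proof -
  interpret A: orthogonal_poset A by (rule orth)
  define i j k where "i = s 1" and "j = s 2" and "k = s 3"
  have ijk: "i \<in> I" "j \<in> I" "k \<in> I"
    and cards: "card (C i \<inter> C j) = 4" "card (C j \<inter> C k) = 4" "card (C k \<inter> C i) = 4"
    and triple: "C i \<inter> C j \<inter> C k = {\<zero>\<^bsub>K i\<^esub>, \<one>\<^bsub>K i\<^esub>}"
    using loop unfolding atomic_loop_3_iff i_def j_def k_def by simp_all
  have triv: "w = \<zero>\<^bsub>A\<^esub> \<or> w = \<one>\<^bsub>A\<^esub>" if "w \<in> C i" "w \<in> C j" "w \<in> C k" for w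
  proof -
    have "w \<in> C i \<inter> C j \<inter> C k" using that by simp
    then show ?thesis unfolding triple using zer_K[OF ijk(1)] uno_K[OF ijk(1)] by simp
  qed
  \<comment> \<open>Equal indices would give an overlap of at least six elements.\<close>
  have ne: "i \<noteq> j" "j \<noteq> k" "k \<noteq> i"
    using cards card_carrier[of i] card_carrier[of j] card_carrier[of k] ijk by auto
  interpret Ki: kleene_lattice "K i" using ijk by (intro member_kleene)
  interpret Kj: kleene_lattice "K j" using ijk by (intro member_kleene)
  interpret Kk: kleene_lattice "K k" using ijk by (intro member_kleene)
  obtain a where a: "atom (K i) a" "atom (K j) a" "a \<in> C i" "a \<in> C j" "a \<noteq> \<zero>\<^bsub>A\<^esub>" "a \<noteq> \<one>\<^bsub>A\<^esub>"
    by (rule overlap_atom[OF ijk(1,2) ne(1) cards(1)])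
  obtain b where b: "atom (K j) b" "atom (K k) b" "b \<in> C j" "b \<in> C k" "b \<noteq> \<zero>\<^bsub>A\<^esub>" "b \<noteq> \<one>\<^bsub>A\<^esub>"
    by (rule overlap_atom[OF ijk(2,3) ne(2) cards(2)])
  obtain c where c: "atom (K k) c" "atom (K i) c" "c \<in> C k" "c \<in> C i" "c \<noteq> \<zero>\<^bsub>A\<^esub>" "c \<noteq> \<one>\<^bsub>A\<^esub>"
    by (rule overlap_atom[OF ijk(3,1) ne(3) cards(3)])
  \<comment> \<open>Two coinciding atoms would lie in all three members.\<close>
  have dist: "a \<noteq> b" "c \<noteq> b" "a \<noteq> c" using triv a b c by blast+
  define d where "d = b\<acute>\<^bsub>A\<^esub>"
  have d: "d \<in> C j" "d \<in> C k" using invol_in b ijk d_def by auto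
  have bd: "b\<acute>\<^bsub>K j\<^esub> = d" "b\<acute>\<^bsub>K k\<^esub> = d" using invol_K b ijk d_def by simp_all
  then have d1: "d \<noteq> \<one>\<^bsub>A\<^esub>" "d \<noteq> \<zero>\<^bsub>A\<^esub>"
    using Kj.invol_eq_zer_iff[OF b(3)] Kj.invol_eq_uno_iff[OF b(3)] b(5,6)
      uno_K[OF ijk(2)] zer_K[OF ijk(2)] by simp_all
  have di: "d \<notin> C i" using triv d d1 by blast
  have ad: "a \<sqsubseteq>\<^bsub>A\<^esub> d"
    using Kj.atoms_orthogonal[OF a(2) b(1) dist(1)] le_K[OF ijk(2) a(4) d(1)] bd by simp
  have cd: "c \<sqsubseteq>\<^bsub>A\<^esub> d"
    using Kk.atoms_orthogonal[OF c(1) b(2) dist(2)] le_K[OF ijk(3) c(3) d(2)] bd by simp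
  have ci: "c\<acute>\<^bsub>K i\<^esub> = c\<acute>\<^bsub>A\<^esub>" "c\<acute>\<^bsub>A\<^esub> \<in> C i" using invol_K invol_in c ijk by simp_all
  have ac: "a \<sqsubseteq>\<^bsub>K i\<^esub> c\<acute>\<^bsub>A\<^esub>"
    using Ki.atoms_orthogonal[OF a(1) c(2) dist(3)] ci by simp
  \<comment> \<open>The involute of \<open>c\<close> lies in \<open>K k\<close> too, so equality
    would put \<open>a\<close> in all three members.\<close>
  have nac: "a \<noteq> c\<acute>\<^bsub>A\<^esub>"
    using invol_in[OF ijk(3) c(3)] triv[OF a(3,4)] a(5,6) by auto
  define t where "t = a \<squnion>\<^bsub>K i\<^esub> c"
  have ti: "t \<in> C i" using a(3) c(4) unfolding t_def by simp
  have at: "a \<sqsubseteq>\<^bsub>A\<^esub> t"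
    using Ki.join_left[OF a(3) c(4)] le_K[OF ijk(1) a(3) ti] unfolding t_def by simp
  have ct: "c \<sqsubseteq>\<^bsub>A\<^esub> t"
    using Ki.join_right[OF a(3) c(4)] le_K[OF ijk(1) c(4) ti] unfolding t_def by simp
  have t1: "t \<noteq> \<one>\<^bsub>A\<^esub>"
    using Ki.join_orthogonal_ne_uno[OF a(3) c(4)] ac nac ci uno_K[OF ijk(1)]
    unfolding t_def by simp
  have "a \<sqsubseteq>\<^bsub>A\<^esub> c\<acute>\<^bsub>A\<^esub>" using ac le_K[OF ijk(1) a(3) ci(2)] by simp
  moreover have cA: "a \<in> carrier A" "c \<in> carrier A" "d \<in> carrier A" "t \<in> carrier A"
    using a(3) c(3) d(1) ti ijk by (auto simp: carrier_A)
  ultimately obtain u where u: "least A u (Upper A {a, c})"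
    using A.orthogonal_sup[OF cA(1,2)] by auto
  have au: "a \<sqsubseteq>\<^bsub>A\<^esub> u" "c \<sqsubseteq>\<^bsub>A\<^esub> u" using least_Upper_above[OF u] cA by simp_all
  have ud: "u \<sqsubseteq>\<^bsub>A\<^esub> d" using ad cd cA by (intro least_le[OF u] Upper_memI) auto
  have ut: "u \<sqsubseteq>\<^bsub>A\<^esub> t" using at ct cA by (intro least_le[OF u] Upper_memI) auto
  have u1: "u \<noteq> \<one>\<^bsub>A\<^esub>" using ud d1 A.uno_le_eq[OF cA(3)] by blast
  have u0: "u \<noteq> \<zero>\<^bsub>A\<^esub>" using au(1) a(5) A.le_zer_eq[OF cA(1)] by blast
  have ui: "u \<in> C i"
  proof (rule ccontr)
    assume n: "u \<notin> C i"
    obtain l where l: "l \<in> I" "u \<in> C l" "t \<in> C l" "u \<sqsubseteq>\<^bsub>K l\<^esub> t" using ut le_A by blast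
    \<comment> \<open>If \<open>x\<close> and \<open>t\<close> were related to \<open>u\<close> in
      different members, \<open>u\<close> would be an atom above \<open>x\<close>, so
      \<open>u = x\<close>, or a co-atom below \<open>t\<close>, so \<open>u = t\<close>. Either way
      \<open>u\<close> would be in \<open>C i\<close>.\<close>
    have in_l: "x \<in> C l" if x: "x \<sqsubseteq>\<^bsub>A\<^esub> u" "x \<noteq> \<zero>\<^bsub>A\<^esub>" "x \<in> C i" for x
    proof -
      obtain p where p: "p \<in> I" "x \<in> C p" "u \<in> C p" "x \<sqsubseteq>\<^bsub>K p\<^esub> u" using x le_A by blast
      have "p = l"
      proof (rule ccontr)
        assume "p \<noteq> l"
        then consider "atom (K p) u" | "coatom (K l) u"
          using overlap_extremal[of p l u] p l u0 u1 by blast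
        then show False
        proof cases
          case 1
          then show False using p x n zer_K by (auto simp: atom_def)
        next
          case 2
          then show False using l ti t1 n uno_K by (auto simp: coatom_def)
        qed
      qed
      then show ?thesis using p by blast
    qed
    have "a \<in> C l" "c \<in> C l" using in_l au a c by blast+
    moreover have "i \<noteq> l" using n l by blast
    \<comment> \<open>Now \<open>a\<close> and \<open>c\<close> both lie in the four-element overlap
      of \<open>K i\<close> and \<open>K l\<close>, which leaves only
      \<open>c = a\<acute>\<close>.\<close>
    ultimately have "c \<in> {\<zero>\<^bsub>A\<^esub>, \<one>\<^bsub>A\<^esub>, a, a\<acute>\<^bsub>A\<^esub>}"
      using overlap_eq(1)[of i l a] ijk l a c by blast
    then have "a\<acute>\<^bsub>A\<^esub> = c" using c dist by blast
    then show False using nac A.invol_eq_iff cA by metis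
  qed
  obtain p where p: "p \<in> I" "u \<in> C p" "d \<in> C p" "u \<sqsubseteq>\<^bsub>K p\<^esub> d" using ud le_A by blast
  have "i \<noteq> p" using di p by blast
  \<comment> \<open>An atom \<open>u\<close> of \<open>K i\<close> would equal both \<open>a\<close>
    and \<open>c\<close>; a co-atom \<open>u\<close> of \<open>K p\<close> would equal
    \<open>d\<close>, which is not in \<open>C i\<close>.\<close>
  then consider "atom (K i) u" | "coatom (K p) u"
    using overlap_extremal[of i p u] ijk p ui u0 u1 by blast
  then show False
  proof cases
    case 1
    then have "a = u" "c = u"
      using au a c ui ijk le_K zer_K by (auto simp: atom_def)
    then show False using dist by blast
  next
    case 2
    then show False using p d1 di ui uno_K by (auto simp: coatom_def)
  qed
qed

end

theorem theorem4p10: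
  fixes I :: "'i set" and K :: "'i \<Rightarrow> 'a inv_poset"
  assumes "pasted_family I K"
  shows "sharply_paraorthomodular_poset (atomic_amalgam I K) \<longleftrightarrow>
    \<not> (\<exists>s. atomic_loop I K 3 s)"
proof -
  interpret pasted_family I K by (rule assms)
  \<comment> \<open>Paraorthomodularity always holds, so only orthogonality depends on
    loops.\<close>
  show ?thesis
    using orthogonal_if_no_loop not_orthogonal_if_loop amalgam_paraorthomodular
    unfolding sharply_paraorthomodular_poset_def by blast
qed

end
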